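(* There exists a regular game $\mathcal{G}$ with imperfect information, with a rectangular morphism $h$ for $\mathcal{G}$, such that the abstract game $\mathcal{H}$ induced from $\mathcal{G}$ (by $h$) is not alternating probabilistic trace equivalent to $\mathcal{G}$.
   Context: **Games.** A game with imperfect information is $\mathcal{G}=\langle A,\mathsf{act},\sim,\lambda\rangle$ over a finite set $\Gamma$ of moves and a finite set $C$ of colors, where $A$ is a finite nonempty set of actions, $\mathsf{act}:\Gamma\to A$ is surjective. In each of infinitely many rounds the player chooses an action $a\in A$, then the environment chooses a move $c\in\Gamma$ with $\mathsf{act}(c)=a$. A history is an element of $\Gamma^*$, a play an element of $\Gamma^\omega$. The relation $\sim$ on $\Gamma^*$ is an indistinguishability relation: an equivalence such that (i) $\tau\sim\tau'$ implies $|\tau|=|\tau'|$; (ii) $\tau c\sim\tau'c'$ (with $c,c'\in\Gamma$) implies $\tau\sim\tau'$ and $\mathsf{act}(c)=\mathsf{act}(c')$. $[\tau]_\sim$ is the equivalence class of $\tau$. The coloring function $\lambda:\Gamma^*\to C$ is regular (computed by a finite-state Moore machine reading the history) and information consistent: $\tau\sim\tau'$ implies $\lambda(\tau)=\lambda(\tau')$. For a play $\pi=c_1c_2\dots$, $\hat\lambda(\pi)=\lambda(c_1)\lambda(c_1c_2)\cdots\in C^\omega$. **Strategies.** $\mathcal{D}(S)$ denotes the probability distributions on $S$. A player strategy in $\mathcal{G}$ is $\alpha:\Gamma^*\to\mathcal{D}(A)$ with $\alpha(\tau)=\alpha(\tau')$ whenever $\tau\sim\tau'$. An environment strategy is $\beta:\Gamma^*\times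 A\to\mathcal{D}(\Gamma)$ such that $\beta(\tau,a)(c)>0$ implies $\mathsf{act}(c)=a$. $\Pr^{\alpha,\beta}$ is the probability measure on plays with $\Pr^{\alpha,\beta}(c_1\dots c_k\Gamma^\omega)=\prod_{i=1}^k\alpha(c_1\dots c_{i-1})(\mathsf{act}(c_i))\cdot\beta(c_1\dots c_{i-1},\mathsf{act}(c_i))(c_i)$; for measurable $L\subseteq C^\omega$, $\Pr^{\alpha,\beta}(L)$ means $\Pr^{\alpha,\beta}(\{\pi:\hat\lambda(\pi)\in L\})$. **Rectangular morphism, regular game.** A rectangular morphism for $\mathcal{G}$ is a surjective function $h:\Gamma^*\to P$ with $P$ finite, such that for all $\tau,\tau'\in\Gamma^*$ with $h(\tau)=h(\tau')$ and all $c\in\Gamma$: $h([\tau]_\sim)=h([\tau']_\sim)$ (images of sets), $h(\tau c)=h(\tau'c)$, and $\lambda(\tau)=\lambda(\tau')$. A game is regular if it admits a rectangular morphism. Let $\approx\ =\{(h(\tau),h(\tau')):\tau\sim\tau'\}$ (known to be an equivalence relation on $P$), and let $\hat h:\Gamma^*\to P^*$, $\hat h(c_1\dots c_k)=h(c_1)h(c_1c_2)\cdots h(c_1\dots c_k)$, $\hat h(\epsilon)=\epsilon$. **Abstract game $\mathcal{H}$ induced from $\mathcal{G}$ by $h$.** Its histories are the sequences $\rho\in\hat h(\Gamma^* )$, starting from $\epsilon$. From a history $\rho$, the player chooses an action $a\in A$, and the environment extends the history to $\rho'=\hat h(\tau c)$ where $\hat h(\tau)=\rho$ and $c\in\Gamma$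 with $\mathsf{act}(c)=a$ (the set of possible $\rho'$ does not depend on the choice of $\tau$). Two histories of $\mathcal{H}$ are indistinguishable if they have the same length and are $\approx$-equivalent at every position. The color of $\rho=\hat h(\tau)$ is $\lambda(\tau)$ (well defined). A player strategy in $\mathcal{H}$ maps histories of $\mathcal{H}$ to $\mathcal{D}(A)$ and is constant on indistinguishable histories; an environment strategy in $\mathcal{H}$ maps each (history, action) to a distribution on the allowed one-step extensions. Such a pair induces, in the same way as in $\mathcal{G}$, a probability measure on infinite plays of $\mathcal{H}$ and hence probabilities $\Pr^{\alpha_\mathcal{H},\beta_\mathcal{H}}(L)$ for measurable $L\subseteq C^\omega$. **Alternating probabilistic trace equivalence.** For games $\mathcal{G},\mathcal{H}$ with the same color alphabet $C$, $\mathcal{G}\preceq\mathcal{H}$ ($\mathcal{G}$ reduces to $\mathcal{H}$) means: for every player strategy $\alpha_\mathcal{G}$ in $\mathcal{G}$ there is a player strategy $\alpha_\mathcal{H}$ in $\mathcal{H}$ such that for every environment strategy $\beta_\mathcal{H}$ in $\mathcal{H}$ there is an environment strategy $\beta_\mathcal{G}$ in $\mathcal{G}$ with $\Pr^{\alpha_\mathcal{G},\beta_\mathcal{G}}(L)=\Pr^{\alpha_\mathcal{H},\beta_\mathcal{H}}(L)$ for all measurable $L\subseteq C^\omega$. The games are alternating probabilistic trace equivalent if $\mathcal{G}\preceq\mathcal{H}$ and $\mathcal{H}\preceq\mathcal{G}$. *)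

theory Defs
  imports "HOL-Probability.Probability"
begin

section \<open>Games with imperfect information\<close>

record ('m, 'a, 'c) game =
  moves :: "'m set"
  actions :: "'a set"
  act :: "'m \<Rightarrow> 'a"
  indist :: "'m list rel"
  colours :: "'c set"
  colour :: "'m list \<Rightarrow> 'c"

definition indistinguishability :: "('m, 'a, 'c) game \<Rightarrow> bool" where
  "indistinguishability G \<longleftrightarrow>
     equiv (lists (moves G)) (indist G) \<and>
     (\<forall>\<tau> \<tau>'. (\<tau>, \<tau>') \<in> indist G \<longrightarrow> length \<tau> = length \<tau>') \<and>
     (\<forall>\<tau> \<tau>' c c'. (\<tau> @ [c], \<tau>' @ [c']) \<in> indist G \<longrightarrow>
        (\<tau>, \<tau>') \<in> indist G \<and> act G c = act G c')"

text \<open>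
  The colouring is computed by a finite Moore machine with initial state \<open>q0\<close>, transition function
  \<open>\<delta>\<close> and output function \<open>out\<close>.  Natural numbers are enough to name its finitely many states.
\<close>

definition regular_colouring :: "('m, 'a, 'c) game \<Rightarrow> bool" where
  "regular_colouring G \<longleftrightarrow>
     (\<exists>(Q :: nat set) q0 \<delta> out.
        finite Q \<and> q0 \<in> Q \<and> (\<forall>q\<in>Q. \<forall>c\<in>moves G. \<delta> q c \<in> Q) \<and> out ` Q \<subseteq> colours G \<and>
        (\<forall>\<tau>\<in>lists (moves G). colour G \<tau> = out (foldl \<delta> q0 \<tau>)))"

definition information_consistent :: "('m, 'a, 'c) game \<Rightarrow> bool" where
  "information_consistent G \<longleftrightarrow>
     (\<forall>\<tau> \<tau>'. (\<tau>, \<tau>') \<in> indist G \<longrightarrow> colour G \<tau> = colour G \<tau>')"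

definition imperfect_information_game :: "('m, 'a, 'c) game \<Rightarrow> bool" where
  "imperfect_information_game G \<longleftrightarrow>
     finite (moves G) \<and> finite (actions G) \<and> actions G \<noteq> {} \<and> finite (colours G) \<and>
     act G ` moves G = actions G \<and>
     indistinguishability G \<and> regular_colouring G \<and> information_consistent G"

definition rectangular_morphism ::
    "('m, 'a, 'c) game \<Rightarrow> 'p set \<Rightarrow> ('m list \<Rightarrow> 'p) \<Rightarrow> bool" where
  "rectangular_morphism G P h \<longleftrightarrow>
     finite P \<and> h ` lists (moves G) = P \<and>
     (\<forall>\<tau>\<in>lists (moves G). \<forall>\<tau>'\<in>lists (moves G). \<forall>c\<in>moves G. h \<tau> = h \<tau>' \<longrightarrow>
        h ` (indist G `` {\<tau>}) = h ` (indist G `` {\<tau>'}) \<and>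
        h (\<tau> @ [c]) = h (\<tau>' @ [c]) \<and>
        colour G \<tau> = colour G \<tau>')"

text \<open>As \<open>P\<close> is finite, it may be taken to be a set of natural numbers.\<close>

definition regular_game :: "('m, 'a, 'c) game \<Rightarrow> bool" where
  "regular_game G \<longleftrightarrow>
     imperfect_information_game G \<and> (\<exists>(P :: nat set) h. rectangular_morphism G P h)"


section \<open>Arenas, strategies and probabilities\<close>

text \<open>
  A game with imperfect information and its induced abstract game differ only in what the letters
  of a history are and which of them the environment may append.  An arena captures what both have
  in common: \<open>succs \<rho> a\<close> is the set of letters that may extend the history \<open>\<rho>\<close> after
  action \<open>a\<close>.  Strategies are total functions; only their values on histories and actions of the
  arena matter.
\<close>

record ('x, 'a, 'c) arena =
  hists :: "'x list set"
  acts :: "'a set"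
  succs :: "'x list \<Rightarrow> 'a \<Rightarrow> 'x set"
  indists :: "'x list rel"
  cols :: "'c set"
  col :: "'x list \<Rightarrow> 'c"

type_synonym ('x, 'a) player = "'x list \<Rightarrow> 'a pmf"
type_synonym ('x, 'a) environment = "'x list \<Rightarrow> 'a \<Rightarrow> 'x pmf"

definition player_strategy :: "('x, 'a, 'c) arena \<Rightarrow> ('x, 'a) player \<Rightarrow> bool" where
  "player_strategy H \<alpha> \<longleftrightarrow>
     (\<forall>\<rho>\<in>hists H. set_pmf (\<alpha> \<rho>) \<subseteq> acts H) \<and>
     (\<forall>\<rho> \<rho>'. (\<rho>, \<rho>') \<in> indists H \<longrightarrow> \<alpha> \<rho> = \<alpha> \<rho>')"

definition environment_strategy :: "('x, 'a, 'c) arena \<Rightarrow> ('x, 'a) environment \<Rightarrow> bool" where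
  "environment_strategy H \<beta> \<longleftrightarrow>
     (\<forall>\<rho>\<in>hists H. \<forall>a\<in>acts H. set_pmf (\<beta> \<rho> a) \<subseteq> succs H \<rho> a)"

text \<open>
  The letter that extends the history \<open>\<rho>\<close> is \<open>x\<close> with probability
  \<open>\<Sum>a. \<alpha>(\<rho>)(a) \<cdot> \<beta>(\<rho>, a)(x)\<close>.  In a game with imperfect information, where a move
  determines its action, only the summand for \<open>a = act x\<close> remains (lemma
  \<open>cylinder_prob_game_arena\<close> below).
\<close>

definition step_pmf :: "('x, 'a) player \<Rightarrow> ('x, 'a) environment \<Rightarrow> 'x list \<Rightarrow> 'x pmf" where
  "step_pmf \<alpha> \<beta> \<rho> = bind_pmf (\<alpha> \<rho>) (\<beta> \<rho>)"

definition cylinder_prob ::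
    "('x, 'a) player \<Rightarrow> ('x, 'a) environment \<Rightarrow> 'x list \<Rightarrow> real" where
  "cylinder_prob \<alpha> \<beta> w = (\<Prod>i<length w. pmf (step_pmf \<alpha> \<beta> (take i w)) (w ! i))"

text \<open>
  The measure lives on all infinite sequences of letters; under strategies of an arena it is
  concentrated on those all of whose prefixes are histories.  Existence and uniqueness are lemma
  \<open>ex1_play_measure\<close> below.
\<close>

definition is_play_measure ::
    "('x, 'a) player \<Rightarrow> ('x, 'a) environment \<Rightarrow> 'x stream measure \<Rightarrow> bool" where
  "is_play_measure \<alpha> \<beta> M \<longleftrightarrow>
     sets M = sets (stream_space (count_space UNIV)) \<and>
     (\<forall>w. emeasure M (sstart UNIV w) = ennreal (cylinder_prob \<alpha> \<beta> w))"

definition play_measure ::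
    "('x, 'a) player \<Rightarrow> ('x, 'a) environment \<Rightarrow> 'x stream measure" where
  "play_measure \<alpha> \<beta> = (THE M. is_play_measure \<alpha> \<beta> M)"

definition colour_trace :: "('x, 'a, 'c) arena \<Rightarrow> 'x stream \<Rightarrow> 'c stream" where
  "colour_trace H \<pi> = to_stream (\<lambda>n. col H (stake (Suc n) \<pi>))"

definition Pr ::
    "('x, 'a, 'c) arena \<Rightarrow> ('x, 'a) player \<Rightarrow> ('x, 'a) environment \<Rightarrow> 'c stream set \<Rightarrow> real" where
  "Pr H \<alpha> \<beta> L = measure (play_measure \<alpha> \<beta>) {\<pi>. colour_trace H \<pi> \<in> L}"

text \<open>Reducibility is only meaningful for arenas with the same colour alphabet.\<close>

definition reduces :: "('x, 'a, 'c) arena \<Rightarrow> ('y, 'b, 'c) arena \<Rightarrow> bool" where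
  "reduces G H \<longleftrightarrow>
     (\<forall>\<alpha>\<^sub>G. player_strategy G \<alpha>\<^sub>G \<longrightarrow>
       (\<exists>\<alpha>\<^sub>H. player_strategy H \<alpha>\<^sub>H \<and>
         (\<forall>\<beta>\<^sub>H. environment_strategy H \<beta>\<^sub>H \<longrightarrow>
           (\<exists>\<beta>\<^sub>G. environment_strategy G \<beta>\<^sub>G \<and>
             (\<forall>L\<in>sets (stream_space (count_space (cols G))).
                Pr G \<alpha>\<^sub>G \<beta>\<^sub>G L = Pr H \<alpha>\<^sub>H \<beta>\<^sub>H L)))))"

definition alternating_probabilistic_trace_equivalent ::
    "('x, 'a, 'c) arena \<Rightarrow> ('y, 'b, 'c) arena \<Rightarrow> bool" where
  "alternating_probabilistic_trace_equivalent G H \<longleftrightarrow> reduces G H \<and> reduces H G"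


section \<open>The arena of a game and the induced abstract game\<close>

definition game_arena :: "('m, 'a, 'c) game \<Rightarrow> ('m, 'a, 'c) arena" where
  "game_arena G =
     \<lparr> hists = lists (moves G),
       acts = actions G,
       succs = (\<lambda>\<tau> a. {c \<in> moves G. act G c = a}),
       indists = indist G,
       cols = colours G,
       col = colour G \<rparr>"

definition approx :: "('m, 'a, 'c) game \<Rightarrow> ('m list \<Rightarrow> 'p) \<Rightarrow> 'p rel" where
  "approx G h = {(h \<tau>, h \<tau>') | \<tau> \<tau>'. (\<tau>, \<tau>') \<in> indist G}"

definition hhat :: "('m list \<Rightarrow> 'p) \<Rightarrow> 'm list \<Rightarrow> 'p list" where
  "hhat h \<tau> = map (\<lambda>i. h (take (Suc i) \<tau>)) [0..<length \<tau>]"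

definition abstract_game ::
    "('m, 'a, 'c) game \<Rightarrow> ('m list \<Rightarrow> 'p) \<Rightarrow> ('p, 'a, 'c) arena" where
  "abstract_game G h =
     \<lparr> hists = hhat h ` lists (moves G),
       acts = actions G,
       succs = (\<lambda>\<rho> a. {p. \<exists>\<tau>\<in>lists (moves G). \<exists>c\<in>moves G.
                 hhat h \<tau> = \<rho> \<and> act G c = a \<and> hhat h (\<tau> @ [c]) = \<rho> @ [p]}),
       indists = {(\<rho>, \<rho>'). \<rho> \<in> hhat h ` lists (moves G) \<and> \<rho>' \<in> hhat h ` lists (moves G) \<and>
                 length \<rho> = length \<rho>' \<and> (\<forall>i<length \<rho>. (\<rho> ! i, \<rho>' ! i) \<in> approx G h)},
       cols = colours G,
       col = (\<lambda>\<rho>. THE k. \<exists>\<tau>\<in>lists (moves G). hhat h \<tau> = \<rho> \<and> colour G \<tau> = k) \<rparr>"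


section \<open>Well-definedness\<close>

lemma hhat_Nil [simp]: "hhat h [] = []"
  by (simp add: hhat_def)

lemma hhat_snoc [simp]: "hhat h (\<tau> @ [c]) = hhat h \<tau> @ [h (\<tau> @ [c])]"
  by (simp add: hhat_def)

lemma length_hhat [simp]: "length (hhat h \<tau>) = length \<tau>"
  by (simp add: hhat_def)

lemma hhat_eq_imp_eq: "hhat h \<tau> = hhat h \<tau>' \<Longrightarrow> h \<tau> = h \<tau>'"
proof (cases \<tau> rule: rev_cases)
  case Nil
  moreover assume "hhat h \<tau> = hhat h \<tau>'"
  ultimately show ?thesis
    by (metis length_hhat length_0_conv)
next
  case (snoc \<sigma> c)
  moreover assume eq: "hhat h \<tau> = hhat h \<tau>'"
  ultimately have "\<tau>' \<noteq> []"
    by auto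
  then show ?thesis
    using eq snoc by (cases \<tau>' rule: rev_cases) auto
qed

lemma col_abstract_game:
  assumes h: "rectangular_morphism G P h" and \<tau>: "\<tau> \<in> lists (moves G)" and ne: "moves G \<noteq> {}"
  shows "col (abstract_game G h) (hhat h \<tau>) = colour G \<tau>"
proof -
  obtain c where c: "c \<in> moves G"
    using ne by auto
  have eq: "colour G \<tau>' = colour G \<tau>" if "\<tau>' \<in> lists (moves G)" "hhat h \<tau>' = hhat h \<tau>" for \<tau>'
  proof -
    have "h \<tau>' = h \<tau>"
      using that(2) by (rule hhat_eq_imp_eq)
    with h that(1) \<tau> c show ?thesis
      unfolding rectangular_morphism_def by metis
  qed
  have "(THE k. \<exists>\<tau>'\<in>lists (moves G). hhat h \<tau>' = hhat h \<tau> \<and> colour G \<tau>' = k) = colour G \<tau>"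
  proof (rule the_equality)
    show "\<exists>\<tau>'\<in>lists (moves G). hhat h \<tau>' = hhat h \<tau> \<and> colour G \<tau>' = colour G \<tau>"
      using \<tau> by (intro bexI[of _ \<tau>]) simp_all
    show "k = colour G \<tau>"
      if "\<exists>\<tau>'\<in>lists (moves G). hhat h \<tau>' = hhat h \<tau> \<and> colour G \<tau>' = k" for k
      using that eq by metis
  qed
  then show ?thesis
    by (simp add: abstract_game_def)
qed

text \<open>The successors in the abstract game do not depend on the chosen preimage of the history.\<close>

lemma succs_abstract_game:
  assumes h: "rectangular_morphism G P h" and \<tau>: "\<tau> \<in> lists (moves G)"
  shows "succs (abstract_game G h) (hhat h \<tau>) a = {h (\<tau> @ [c]) | c. c \<in> moves G \<and> act G c = a}"
proof -
  have "h (\<tau>' @ [c]) = h (\<tau> @ [c])"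
    if "\<tau>' \<in> lists (moves G)" "hhat h \<tau>' = hhat h \<tau>" "c \<in> moves G" for \<tau>' c
  proof -
    have "h \<tau>' = h \<tau>"
      using that(2) by (rule hhat_eq_imp_eq)
    with h that(1,3) \<tau> show ?thesis
      unfolding rectangular_morphism_def by metis
  qed
  then have "(\<exists>\<tau>'\<in>lists (moves G). \<exists>c\<in>moves G. hhat h \<tau>' = hhat h \<tau> \<and> act G c = a \<and>
        hhat h (\<tau>' @ [c]) = hhat h \<tau> @ [p]) \<longleftrightarrow> (\<exists>c. p = h (\<tau> @ [c]) \<and> c \<in> moves G \<and> act G c = a)" for p
    using \<tau> unfolding hhat_snoc by (metis append1_eq_conv)
  then show ?thesis
    by (simp only: abstract_game_def arena.simps)
qed

text \<open>The product formula for the cylinder probabilities in a game with imperfect information.\<close>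

lemma cylinder_prob_game_arena:
  assumes G: "imperfect_information_game G"
    and \<alpha>: "player_strategy (game_arena G) \<alpha>"
    and \<beta>: "environment_strategy (game_arena G) \<beta>"
    and w: "w \<in> lists (moves G)"
  shows "cylinder_prob \<alpha> \<beta> w =
    (\<Prod>i<length w. pmf (\<alpha> (take i w)) (act G (w ! i)) * pmf (\<beta> (take i w) (act G (w ! i))) (w ! i))"
  unfolding cylinder_prob_def
proof (rule prod.cong[OF refl])
  fix i assume "i \<in> {..<length w}"
  then have i: "i < length w" by simp
  let ?\<rho> = "take i w" and ?x = "w ! i"
  have \<rho>: "?\<rho> \<in> lists (moves G)" and x: "?x \<in> moves G"
    using w i by (auto dest: in_set_takeD)
  have fin: "finite (actions G)" and xa: "act G ?x \<in> actions G"
    using G x by (auto simp: imperfect_information_game_def)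
  have sub: "set_pmf (\<alpha> ?\<rho>) \<subseteq> actions G"
    using \<alpha> \<rho> by (simp add: player_strategy_def game_arena_def)
  have zero: "pmf (\<beta> ?\<rho> a) ?x = 0" if "a \<in> actions G" "a \<noteq> act G ?x" for a
    using \<beta> \<rho> that unfolding environment_strategy_def game_arena_def
    by (auto simp: pmf_eq_0_set_pmf)
  have "pmf (step_pmf \<alpha> \<beta> ?\<rho>) ?x = (\<Sum>a\<in>actions G. pmf (\<alpha> ?\<rho>) a * pmf (\<beta> ?\<rho> a) ?x)"
    unfolding step_pmf_def pmf_bind
    by (subst integral_measure_pmf[OF fin]) (use sub in \<open>auto simp: mult.commute\<close>)
  also have "\<dots> = (\<Sum>a\<in>{act G ?x}. pmf (\<alpha> ?\<rho>) a * pmf (\<beta> ?\<rho> a) ?x)"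
    using fin xa zero by (intro sum.mono_neutral_right) auto
  finally show "pmf (step_pmf \<alpha> \<beta> ?\<rho>) ?x
      = pmf (\<alpha> ?\<rho>) (act G ?x) * pmf (\<beta> ?\<rho> (act G ?x)) ?x"
    by simp
qed

lemma sstart_UNIV: "sstart UNIV w = {\<pi>. stake (length w) \<pi> = w}"
proof -
  have "\<pi> \<in> sstart UNIV w \<longleftrightarrow> stake (length w) \<pi> = w" for \<pi>
    by (induction w arbitrary: \<pi>) (simp_all del: sstart.simps(2))
  then show ?thesis
    by blast
qed

lemma is_play_measure_unique:
  fixes \<alpha> :: "('x::countable, 'a) player"
  assumes M: "is_play_measure \<alpha> \<beta> M" and N: "is_play_measure \<alpha> \<beta> N"
  shows "M = N"
proof -
  have prob: "prob_space K" if "is_play_measure \<alpha> \<beta> K" for K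
  proof
    have "space K = UNIV"
      using that sets_eq_imp_space_eq[of K "stream_space (count_space UNIV)"]
      by (auto simp: is_play_measure_def space_stream_space)
    moreover have "emeasure K (sstart UNIV []) = 1"
      using that by (simp add: is_play_measure_def cylinder_prob_def del: sstart.simps)
    ultimately show "emeasure K (space K) = 1"
      by simp
  qed
  show ?thesis
    by (rule stream_space_eq_sstart[where S = UNIV])
       (use M N prob in \<open>auto simp: is_play_measure_def\<close>)
qed

lemma ex_play_measure:
  fixes \<alpha> :: "('x::countable, 'a) player"
  shows "\<exists>M. is_play_measure \<alpha> \<beta> M"
proof -
  define K where "K = (\<lambda>i (\<omega> :: nat \<Rightarrow> 'x). measure_pmf (step_pmf \<alpha> \<beta> (map \<omega> [0..<i])))"
  let ?M = "\<lambda>_ :: nat. count_space (UNIV :: 'x set)"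
  have fin: "PiM {0..<i} ?M = count_space (PiE {0..<i} (\<lambda>_. UNIV))" for i :: nat
    by (rule count_space_PiM_finite) auto
  interpret IT: Ionescu_Tulcea K ?M
  proof (rule Ionescu_Tulcea.intro)
    fix i :: nat and x :: "nat \<Rightarrow> 'x"
    show "K i \<in> measurable (PiM {0..<i} ?M) (subprob_algebra (?M i))"
      unfolding fin K_def by (auto simp: measure_pmf_in_subprob_algebra)
    show "prob_space (K i x)"
      unfolding K_def by unfold_locales
  qed
  have sing: "{restrict x {0..<n}} \<in> sets (PiM {0..<n} ?M)" for n :: nat and x :: "nat \<Rightarrow> 'x"
    unfolding fin by auto
  have C: "emeasure (IT.C 0 n (\<lambda>x. undefined)) {restrict x {0..<n}} =
      (\<Prod>i<n. ennreal (pmf (step_pmf \<alpha> \<beta> (map x [0..<i])) (x i)))" for n x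
  proof (induction n)
    case 0
    have "(\<lambda>x. undefined) = restrict x {0::nat..<0}"
      by auto
    then show ?case
      by (simp add: PiM_empty)
  next
    case (Suc n)
    have [simp]: "(\<lambda>x. undefined) \<in> space (PiM {0::nat..<0} ?M)"
      by (simp add: space_PiM)
    have spC: "space (IT.C 0 n (\<lambda>x. undefined)) = space (PiM {0..<n} ?M)"
      using IT.space_C[of "\<lambda>x. undefined" 0 n] by simp
    have stC: "sets (IT.C 0 n (\<lambda>x. undefined)) = sets (PiM {0..<n} ?M)"
      using IT.sets_C[of "\<lambda>x. undefined" 0 n] by simp
    have neC: "space (IT.C 0 n (\<lambda>x. undefined)) \<noteq> {}"
      unfolding spC by (simp add: space_PiM_empty_iff)
    have eP: "emeasure (IT.eP n \<omega>) {restrict x {0..<Suc n}} =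
        ennreal (pmf (step_pmf \<alpha> \<beta> (map x [0..<n])) (x n)) * indicator {restrict x {0..<n}} \<omega>"
      if \<omega>: "\<omega> \<in> space (PiM {0..<n} ?M)" for \<omega>
    proof -
      have ext: "\<omega> \<in> extensional {0..<n}"
        using \<omega> by (auto simp: space_PiM PiE_def)
      have upd: "fun_upd \<omega> n y = restrict x {0..<Suc n} \<longleftrightarrow> \<omega> = restrict x {0..<n} \<and> y = x n" for y
        using ext by (fastforce simp: fun_eq_iff extensional_def less_Suc_eq split: if_splits)
      have vim: "(\<lambda>y. fun_upd \<omega> n y) -` {restrict x {0..<Suc n}} \<inter> space (count_space UNIV) =
          (if \<omega> = restrict x {0..<n} then {x n} else {})"
        using upd by auto
      have map_eq: "map (restrict x {0..<n}) [0..<n] = map x [0..<n]"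
        by auto
      show ?thesis
        unfolding IT.emeasure_eP[OF \<omega> sing] vim
        by (auto simp: K_def emeasure_pmf_single map_eq simp del: map_eq_conv restrict_apply)
    qed
    have "emeasure (IT.C 0 (Suc n) (\<lambda>x. undefined)) {restrict x {0..<Suc n}} =
        (\<integral>\<^sup>+\<omega>. emeasure (IT.eP n \<omega>) {restrict x {0..<Suc n}} \<partial>IT.C 0 n (\<lambda>x. undefined))"
      using sing[of x "Suc n"] IT.measurable_eP[of n] neC
      unfolding IT.C.simps add_0
      by (intro emeasure_bind[where N = "PiM {0..<Suc n} ?M"])
         (simp_all only: measurable_cong_sets[OF stC refl] not_False_eq_True)
    also have "\<dots> = (\<integral>\<^sup>+\<omega>. ennreal (pmf (step_pmf \<alpha> \<beta> (map x [0..<n])) (x n))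
        * indicator {restrict x {0..<n}} \<omega> \<partial>IT.C 0 n (\<lambda>x. undefined))"
      by (rule nn_integral_cong) (simp add: spC eP)
    also have "\<dots> = ennreal (pmf (step_pmf \<alpha> \<beta> (map x [0..<n])) (x n))
        * emeasure (IT.C 0 n (\<lambda>x. undefined)) {restrict x {0..<n}}"
      by (rule nn_integral_cmult_indicator) (use sing stC in auto)
    finally show ?case
      by (simp only: Suc.IH prod.lessThan_Suc mult.commute)
  qed
  define M where "M = distr IT.PF.lim (stream_space (count_space UNIV)) to_stream"
  have meas: "to_stream \<in> measurable IT.PF.lim (stream_space (count_space UNIV))"
    using measurable_to_stream by (simp add: measurable_cong_sets[OF IT.PF.sets_lim refl])
  have "emeasure M (sstart UNIV w) = ennreal (cylinder_prob \<alpha> \<beta> w)" for w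
  proof -
    let ?n = "length w" and ?x = "\<lambda>i. w ! i"
    have "to_stream -` sstart UNIV w \<inter> space IT.PF.lim =
        IT.PF.emb UNIV {0..<?n} {restrict ?x {0..<?n}}"
    proof -
      have "to_stream \<omega> \<in> sstart UNIV w \<longleftrightarrow> (\<forall>i<?n. \<omega> i = w ! i)" for \<omega>
        by (subst sstart_eq) (simp_all add: to_stream_def)
      moreover have "restrict \<omega> {0..<?n} = restrict ?x {0..<?n} \<longleftrightarrow> (\<forall>i<?n. \<omega> i = w ! i)" for \<omega>
        by (metis atLeastLessThan_iff restrict_apply' restrict_ext zero_le)
      ultimately show ?thesis
        unfolding prod_emb_def IT.PF.space_lim space_PiM by (simp add: set_eq_iff)
    qed
    then have "emeasure M (sstart UNIV w) =
        emeasure IT.PF.lim (IT.PF.emb UNIV {0..<?n} {restrict ?x {0..<?n}})"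
      unfolding M_def by (simp add: emeasure_distr[OF meas] sstart_sets)
    also have "\<dots> = emeasure (IT.CI {0..<?n}) {restrict ?x {0..<?n}}"
      by (rule IT.lim) (use sing in auto)
    also have "\<dots> = emeasure (IT.C 0 ?n (\<lambda>x. undefined))
        (IT.PF.emb {0..<?n} {0..<?n} {restrict ?x {0..<?n}})"
      by (rule IT.emeasure_CI) (use sing in auto)
    also have "IT.PF.emb {0..<?n} {0..<?n} {restrict ?x {0..<?n}} = {restrict ?x {0..<?n}}"
      by (rule prod_emb_id) (auto simp: PiE_def)
    also have "emeasure (IT.C 0 ?n (\<lambda>x. undefined)) {restrict ?x {0..<?n}} =
        (\<Prod>i<?n. ennreal (pmf (step_pmf \<alpha> \<beta> (map ?x [0..<i])) (?x i)))"
      by (rule C)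
    also have "\<dots> = (\<Prod>i<?n. ennreal (pmf (step_pmf \<alpha> \<beta> (take i w)) (?x i)))"
      by (rule prod.cong) (auto intro!: arg_cong[where f = ennreal] arg_cong2[where f = pmf]
           arg_cong[where f = "step_pmf \<alpha> \<beta>"] nth_equalityI)
    also have "\<dots> = ennreal (cylinder_prob \<alpha> \<beta> w)"
      unfolding cylinder_prob_def by (rule prod_ennreal) simp
    finally show ?thesis .
  qed
  then have "is_play_measure \<alpha> \<beta> M"
    by (simp add: is_play_measure_def M_def)
  then show ?thesis ..
qed

lemma ex1_play_measure:
  fixes \<alpha> :: "('x::countable, 'a) player"
  shows "\<exists>!M. is_play_measure \<alpha> \<beta> M"
  using ex_play_measure[of \<alpha> \<beta>] is_play_measure_unique[of \<alpha> \<beta>] by (auto intro: ex_ex1I)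

lemma play_measure:
  fixes \<alpha> :: "('x::countable, 'a) player"
  shows "is_play_measure \<alpha> \<beta> (play_measure \<alpha> \<beta>)"
  unfolding play_measure_def by (rule theI'[OF ex1_play_measure])

lemma colour_trace_event_measurable:
  fixes \<alpha> :: "('x::countable, 'a) player" and H :: "('x, 'a, 'c::countable) arena"
  assumes L: "L \<in> sets (stream_space (count_space (cols H)))"
  shows "{\<pi>. colour_trace H \<pi> \<in> L} \<in> sets (play_measure \<alpha> \<beta>)"
proof -
  let ?U = "stream_space (count_space (UNIV :: 'x set))"
  let ?V = "stream_space (count_space (UNIV :: 'c set))"
  have "(\<lambda>\<pi>. col H (stake (Suc n) \<pi>)) \<in> measurable ?U (count_space UNIV)" for n
    by (rule measurable_compose[OF measurable_stake]) simp
  then have tr: "colour_trace H \<in> measurable ?U ?V"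
    unfolding colour_trace_def to_stream_def by (intro measurable_stream_space2) simp
  have "L \<in> sets ?V"
  proof (cases "cols H = {}")
    case True
    then have "L = {}"
      using sets.sets_into_space[OF L] by (auto simp: space_stream_space streams_empty)
    then show ?thesis by simp
  next
    case False
    then obtain c where c: "c \<in> cols H" by auto
    define f where "f = (\<lambda>x. if x \<in> cols H then x else c)"
    have "f \<in> measurable (count_space UNIV) (count_space (cols H))"
      using c by (auto simp: f_def)
    then have "smap f -` L \<inter> space ?V \<in> sets ?V"
      by (rule measurable_sets[OF measurable_smap L])
    moreover have "streams (cols H) \<in> sets ?V"
      by (rule streams_sets) auto
    moreover have "smap f s = s" if "s \<in> streams (cols H)" for s
      using that by (intro stream.map_ident_strong) (auto simp: f_def streams_iff_sset)
    then have "L = (smap f -` L \<inter> space ?V) \<inter> streams (cols H)"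
      using sets.sets_into_space[OF L] by (auto simp: space_stream_space)
    ultimately show ?thesis
      by (metis sets.Int)
  qed
  then have "colour_trace H -` L \<inter> space ?U \<in> sets ?U"
    by (rule measurable_sets[OF tr])
  moreover have "sets (play_measure \<alpha> \<beta>) = sets ?U"
    using play_measure[of \<alpha> \<beta>] by (simp add: is_play_measure_def)
  ultimately show ?thesis
    by (simp add: space_stream_space vimage_def)
qed

end

theory Submission
  imports Defs
begin

text \<open>
  The environment secretly picks a bit \<open>s\<close>.  The player then either stops, which reveals \<open>s\<close>, or
  goes on; in the latter case the environment replaces \<open>s\<close> by \<open>s + f\<close> modulo 2, the player makes
  a guess \<open>a\<close>, and \<open>s + f + a\<close> is revealed.  In the game, \<open>f\<close> is visible to the player, and a player
  who stops with probability 1/2 and guesses \<open>f\<close> otherwise forces the revealed bit to be the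
  initial bit \<open>s\<close>, hence independent of the stopping time.  The morphism only keeps the current
  bit, about which \<open>f\<close> alone tells nothing; so in the abstract game the player does not see \<open>f\<close>,
  and the environment can choose the bits revealed early and late independently of each other.
\<close>

section \<open>Distributions of finite histories and colour sequences\<close>

text \<open>These are the finite marginals of the play measure, kept as discrete distributions so
  that the example can be computed round by round instead of on streams.\<close>

primrec history_pmf ::
    "('x, 'a) player \<Rightarrow> ('x, 'a) environment \<Rightarrow> nat \<Rightarrow> 'x list pmf" where
  "history_pmf \<alpha> \<beta> 0 = return_pmf []"
| "history_pmf \<alpha> \<beta> (Suc n) =
     bind_pmf (history_pmf \<alpha> \<beta> n) (\<lambda>w. map_pmf (\<lambda>x. w @ [x]) (step_pmf \<alpha> \<beta> w))"

definition colours_along :: "('x, 'a, 'c) arena \<Rightarrow> 'x list \<Rightarrow> 'c list" where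
  "colours_along H w = map (\<lambda>i. col H (take (Suc i) w)) [0..<length w]"

definition colour_pmf ::
    "('x, 'a, 'c) arena \<Rightarrow> ('x, 'a) player \<Rightarrow> ('x, 'a) environment \<Rightarrow> nat \<Rightarrow> 'c list pmf" where
  "colour_pmf H \<alpha> \<beta> n = map_pmf (colours_along H) (history_pmf \<alpha> \<beta> n)"

text \<open>The fields of an arena record are unrelated a priori. This closure keeps plays within
  \<open>hists H\<close>, and hence colour traces within \<open>streams (cols H)\<close>, almost
  surely.\<close>

definition closed_arena :: "('x, 'a, 'c) arena \<Rightarrow> bool" where
  "closed_arena H \<longleftrightarrow> [] \<in> hists H \<and>
     (\<forall>\<rho>\<in>hists H. \<forall>a\<in>acts H. \<forall>x\<in>succs H \<rho> a. \<rho> @ [x] \<in> hists H) \<and>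
     (\<forall>\<rho>\<in>hists H. col H \<rho> \<in> cols H)"

lemma length_history_pmf: "w \<in> set_pmf (history_pmf \<alpha> \<beta> n) \<Longrightarrow> length w = n"
  by (induction n arbitrary: w) auto

lemma pmf_history_snoc:
  "pmf (history_pmf \<alpha> \<beta> (Suc n)) (v @ [y]) =
     pmf (history_pmf \<alpha> \<beta> n) v * pmf (step_pmf \<alpha> \<beta> v) y"
proof -
  have *: "pmf (map_pmf (\<lambda>x. w @ [x]) (step_pmf \<alpha> \<beta> w)) (v @ [y]) =
      indicator {v} w * pmf (step_pmf \<alpha> \<beta> v) y" for w
  proof (cases "w = v")
    case True
    then show ?thesis
      using pmf_map_inj'[of "\<lambda>x. v @ [x]"] by (simp add: inj_def)
  next
    case False
    then show ?thesis
      by (auto simp: pmf_eq_0_set_pmf)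
  qed
  show ?thesis
    by (simp add: pmf_bind * measure_pmf_single)
qed

lemma pmf_history:
  "pmf (history_pmf \<alpha> \<beta> n) w = (if length w = n then cylinder_prob \<alpha> \<beta> w else 0)"
proof (cases "length w = n")
  case True
  then show ?thesis
  proof (induction w arbitrary: n rule: rev_induct)
    case Nil
    then show ?case
      by (simp add: cylinder_prob_def)
  next
    case (snoc y v)
    have "cylinder_prob \<alpha> \<beta> (v @ [y]) = cylinder_prob \<alpha> \<beta> v * pmf (step_pmf \<alpha> \<beta> v) y"
      by (simp add: cylinder_prob_def nth_append)
    with snoc show ?case
      by (auto simp: pmf_history_snoc simp del: history_pmf.simps)
  qed
next
  case False
  then show ?thesis
    using length_history_pmf by (auto simp: pmf_eq_0_set_pmf)
qed

section \<open>Finite marginals of the play measure\<close>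

lemma sets_play_measure:
  fixes \<alpha> :: "('x::countable, 'a) player"
  shows "sets (play_measure \<alpha> \<beta>) = sets (stream_space (count_space UNIV))"
  using play_measure[of \<alpha> \<beta>] by (simp add: is_play_measure_def)

lemma space_play_measure:
  fixes \<alpha> :: "('x::countable, 'a) player"
  shows "space (play_measure \<alpha> \<beta>) = UNIV"
  using sets_eq_imp_space_eq[OF sets_play_measure[of \<alpha> \<beta>]] by (simp add: space_stream_space)

lemma stake_measurable_play_measure:
  fixes \<alpha> :: "('x::countable, 'a) player"
  shows "stake n \<in> measurable (play_measure \<alpha> \<beta>) (count_space UNIV)"
  by (simp add: measurable_cong_sets[OF sets_play_measure refl])

text \<open>There are countably many lists, so comparing point masses is enough; the preimage of a
  list under \<open>stake n\<close> is a cylinder or empty.\<close>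

lemma distr_stake_play_measure:
  fixes \<alpha> :: "('x::countable, 'a) player"
  shows "distr (play_measure \<alpha> \<beta>) (count_space UNIV) (stake n) = history_pmf \<alpha> \<beta> n"
proof (rule measure_eqI_countable[where A = UNIV])
  fix w :: "'x list"
  have "emeasure (play_measure \<alpha> \<beta>) {\<pi>. stake n \<pi> = w} =
      ennreal (if length w = n then cylinder_prob \<alpha> \<beta> w else 0)"
  proof (cases "length w = n")
    case True
    then have "{\<pi>. stake n \<pi> = w} = sstart UNIV w"
      by (simp add: sstart_UNIV)
    with True show ?thesis
      using play_measure[of \<alpha> \<beta>] by (simp add: is_play_measure_def)
  next
    case False
    then have "{\<pi>. stake n \<pi> = w} = {}"
      by auto
    with False show ?thesis
      by simp
  qed
  then show "emeasure (distr (play_measure \<alpha> \<beta>) (count_space UNIV) (stake n)) {w} =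
      emeasure (history_pmf \<alpha> \<beta> n) {w}"
    by (simp add: emeasure_distr[OF stake_measurable_play_measure] vimage_def space_play_measure
        emeasure_pmf_single pmf_history)
qed auto

lemma measure_stake_play_measure:
  fixes \<alpha> :: "('x::countable, 'a) player"
  shows "measure (play_measure \<alpha> \<beta>) {\<pi>. stake n \<pi> \<in> A} = measure (history_pmf \<alpha> \<beta> n) A"
  using measure_distr[OF stake_measurable_play_measure, of A \<alpha> \<beta> n]
  by (simp add: distr_stake_play_measure vimage_def space_play_measure)

lemma set_history_pmf:
  assumes H: "closed_arena H" and \<alpha>: "player_strategy H \<alpha>" and \<beta>: "environment_strategy H \<beta>"
  shows "set_pmf (history_pmf \<alpha> \<beta> n) \<subseteq> hists H"
proof (induction n)
  case 0
  then show ?case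
    using H by (simp add: closed_arena_def)
next
  case (Suc n)
  show ?case
  proof
    fix v assume "v \<in> set_pmf (history_pmf \<alpha> \<beta> (Suc n))"
    then obtain w a x where w: "w \<in> set_pmf (history_pmf \<alpha> \<beta> n)" and a: "a \<in> set_pmf (\<alpha> w)"
      and x: "x \<in> set_pmf (\<beta> w a)" and v: "v = w @ [x]"
      by (auto simp: step_pmf_def)
    have wH: "w \<in> hists H"
      using w Suc by auto
    moreover have aH: "a \<in> acts H"
      using \<alpha> a wH by (auto simp: player_strategy_def)
    moreover have "x \<in> succs H w a"
      using \<beta> x wH aH by (auto simp: environment_strategy_def)
    ultimately show "v \<in> hists H"
      using H v by (auto simp: closed_arena_def)
  qed
qed

lemma stake_colour_trace: "stake n (colour_trace H \<pi>) = colours_along H (stake n \<pi>)"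
proof (rule nth_equalityI)
  fix i assume "i < length (stake n (colour_trace H \<pi>))"
  then show "stake n (colour_trace H \<pi>) ! i = colours_along H (stake n \<pi>) ! i"
    by (simp add: colours_along_def colour_trace_def to_stream_def take_stake min_def)
qed (simp add: colours_along_def)

text \<open>The play measure lives on all sequences of letters, so the claim holds only almost
  surely; it follows from one almost sure event for each prefix length.\<close>

lemma AE_colour_trace_in_streams:
  fixes \<alpha> :: "('x::countable, 'a) player"
  assumes H: "closed_arena H" and \<alpha>: "player_strategy H \<alpha>" and \<beta>: "environment_strategy H \<beta>"
  shows "AE \<pi> in play_measure \<alpha> \<beta>. colour_trace H \<pi> \<in> streams (cols H)"
proof -
  have "AE \<pi> in play_measure \<alpha> \<beta>. stake n \<pi> \<in> hists H" for n
  proof -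
    have "AE w in distr (play_measure \<alpha> \<beta>) (count_space UNIV) (stake n). w \<in> hists H"
      unfolding distr_stake_play_measure
      using set_history_pmf[OF assms] by (auto simp: AE_measure_pmf_iff)
    then show ?thesis
      by (subst (asm) AE_distr_iff[OF stake_measurable_play_measure]) auto
  qed
  then have "AE \<pi> in play_measure \<alpha> \<beta>. \<forall>n. stake n \<pi> \<in> hists H"
    by (simp add: AE_all_countable)
  then show ?thesis
    by (rule AE_mp, intro AE_I2)
      (use H in \<open>auto simp: closed_arena_def streams_iff_snth colour_trace_def to_stream_def
         simp del: stake.simps\<close>)
qed

text \<open>The events compared by \<open>reduces\<close> are subsets of
  \<open>streams (cols H)\<close>, whence the restriction; it changes the event by a null set
  only.\<close>

lemma Pr_stake:
  fixes \<alpha> :: "('x::countable, 'a) player" and H :: "('x, 'a, 'c::countable) arena"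
  assumes H: "closed_arena H" and \<alpha>: "player_strategy H \<alpha>" and \<beta>: "environment_strategy H \<beta>"
  shows "Pr H \<alpha> \<beta> {s \<in> streams (cols H). stake n s = ks} = pmf (colour_pmf H \<alpha> \<beta> n) ks"
    and "{s \<in> streams (cols H). stake n s = ks} \<in> sets (stream_space (count_space (cols H)))"
proof -
  let ?L = "{s \<in> streams (cols H). stake n s = ks}"
  \<comment> \<open>Mapping with \<open>id\<close> passes from the alphabet \<open>cols H\<close> to
    \<open>UNIV\<close>, where \<open>stake\<close> is known to be measurable.\<close>
  have "stake n \<in> measurable (stream_space (count_space (cols H))) (count_space UNIV)"
    using measurable_compose[OF measurable_smap[of id "count_space (cols H)" "count_space UNIV"]
        measurable_stake] by simp
  from measurable_sets[OF this, of "{ks}"]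
  show L: "?L \<in> sets (stream_space (count_space (cols H)))"
    by (simp add: space_stream_space vimage_def Int_def conj_commute)
  have stake: "{\<pi>. stake n (colour_trace H \<pi>) = ks} = {\<pi>. stake n \<pi> \<in> colours_along H -` {ks}}"
    by (simp add: stake_colour_trace)
  have "Pr H \<alpha> \<beta> ?L = measure (play_measure \<alpha> \<beta>) {\<pi>. stake n (colour_trace H \<pi>) = ks}"
    unfolding Pr_def
  proof (rule measure_eq_AE)
    show "AE \<pi> in play_measure \<alpha> \<beta>. \<pi> \<in> {\<pi>. colour_trace H \<pi> \<in> ?L} \<longleftrightarrow>
        \<pi> \<in> {\<pi>. stake n (colour_trace H \<pi>) = ks}"
      using AE_colour_trace_in_streams[OF assms] by eventually_elim simp
    show "{\<pi>. colour_trace H \<pi> \<in> ?L} \<in> sets (play_measure \<alpha> \<beta>)"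
      by (rule colour_trace_event_measurable[OF L])
    show "{\<pi>. stake n (colour_trace H \<pi>) = ks} \<in> sets (play_measure \<alpha> \<beta>)"
      unfolding stake
      using measurable_sets[OF stake_measurable_play_measure, of "colours_along H -` {ks}"]
      by (simp add: vimage_def space_play_measure)
  qed
  also have "\<dots> = pmf (colour_pmf H \<alpha> \<beta> n) ks"
    unfolding stake measure_stake_play_measure colour_pmf_def by (simp add: pmf_map)
  finally show "Pr H \<alpha> \<beta> ?L = pmf (colour_pmf H \<alpha> \<beta> n) ks" .
qed

text \<open>Colour cylinders are measurable, so agreement on all events forces agreement of all
  prefix laws. Refuting \<open>reduces\<close> becomes a comparison of discrete
  distributions.\<close>

lemma reduces_colour_pmf:
  fixes G :: "('x::countable, 'a, 'c::countable) arena" and H :: "('y::countable, 'b, 'c) arena"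
  assumes red: "reduces G H" and G: "closed_arena G" and H: "closed_arena H"
    and cols: "cols G = cols H" and \<alpha>: "player_strategy G \<alpha>"
  obtains \<alpha>' where "player_strategy H \<alpha>'"
    and "\<And>\<beta>'. environment_strategy H \<beta>' \<Longrightarrow>
      \<exists>\<beta>. environment_strategy G \<beta> \<and> (\<forall>n. colour_pmf G \<alpha> \<beta> n = colour_pmf H \<alpha>' \<beta>' n)"
proof -
  obtain \<alpha>' where \<alpha>': "player_strategy H \<alpha>'"
    and sim: "\<And>\<beta>'. environment_strategy H \<beta>' \<Longrightarrow> \<exists>\<beta>. environment_strategy G \<beta> \<and>
      (\<forall>L\<in>sets (stream_space (count_space (cols G))). Pr G \<alpha> \<beta> L = Pr H \<alpha>' \<beta>' L)"
    using red \<alpha> unfolding reduces_def by blast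
  show thesis
  proof (rule that[OF \<alpha>'])
    fix \<beta>' assume \<beta>': "environment_strategy H \<beta>'"
    then obtain \<beta> where \<beta>: "environment_strategy G \<beta>"
      and eq: "\<forall>L\<in>sets (stream_space (count_space (cols G))). Pr G \<alpha> \<beta> L = Pr H \<alpha>' \<beta>' L"
      using sim by blast
    have "colour_pmf G \<alpha> \<beta> n = colour_pmf H \<alpha>' \<beta>' n" for n
      using eq Pr_stake[OF G \<alpha> \<beta>] Pr_stake[OF H \<alpha>' \<beta>'] cols by (intro pmf_eqI) metis
    with \<beta> show "\<exists>\<beta>. environment_strategy G \<beta> \<and>
        (\<forall>n. colour_pmf G \<alpha> \<beta> n = colour_pmf H \<alpha>' \<beta>' n)"
      by blast
  qed
qed

section \<open>Closure of the game and of its abstract game\<close>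

lemma closed_game_arena:
  assumes "imperfect_information_game G"
  shows "closed_arena (game_arena G)"
proof -
  obtain Q q0 \<delta> out where Q: "q0 \<in> Q" "\<forall>q\<in>Q. \<forall>c\<in>moves G. \<delta> q c \<in> (Q :: nat set)"
    "out ` Q \<subseteq> colours G" "\<forall>\<tau>\<in>lists (moves G). colour G \<tau> = out (foldl \<delta> q0 \<tau>)"
    using assms unfolding imperfect_information_game_def regular_colouring_def by metis
  \<comment> \<open>Colours are confined to the alphabet because the Moore machine never leaves
    \<open>Q\<close>.\<close>
  have "foldl \<delta> q0 \<tau> \<in> Q" if "\<tau> \<in> lists (moves G)" for \<tau>
    using that by (induction \<tau> rule: rev_induct) (use Q in auto)
  then have "colour G \<tau> \<in> colours G" if "\<tau> \<in> lists (moves G)" for \<tau>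
    using Q that by (metis image_subset_iff)
  then show ?thesis
    by (auto simp: closed_arena_def game_arena_def)
qed

lemma closed_abstract_game:
  assumes G: "imperfect_information_game G" and h: "rectangular_morphism G P h"
  shows "closed_arena (abstract_game G h)"
proof -
  have ne: "moves G \<noteq> {}"
    using G by (auto simp: imperfect_information_game_def)
  have "colour G \<tau> \<in> colours G" if "\<tau> \<in> lists (moves G)" for \<tau>
    using closed_game_arena[OF G] that by (auto simp: closed_arena_def game_arena_def)
  then have "col (abstract_game G h) \<rho> \<in> colours G" if "\<rho> \<in> hhat h ` lists (moves G)" for \<rho>
    using that col_abstract_game[OF h _ ne] by fastforce
  moreover have "[] \<in> hhat h ` lists (moves G)"
    by (rule image_eqI[of _ _ "[]"]) auto
  moreover have "hhat h \<tau> @ [p] \<in> hhat h ` lists (moves G)"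
    if \<tau>: "\<tau> \<in> lists (moves G)" and p: "p \<in> succs (abstract_game G h) (hhat h \<tau>) a" for \<tau> a p
  proof -
    obtain c where "c \<in> moves G" "p = h (\<tau> @ [c])"
      using p succs_abstract_game[OF h \<tau>] by auto
    then show ?thesis
      using \<tau> by (intro image_eqI[of _ _ "\<tau> @ [c]"]) auto
  qed
  ultimately show ?thesis
    by (auto simp: closed_arena_def abstract_game_def)
qed


section \<open>The counterexample\<close>

text \<open>
  A move \<open>c\<close> consists of the action \<open>c div 2\<close> (0 for stopping) and the bit \<open>c mod 2\<close> chosen by the
  environment.  State 0 is initial, \<open>1 + s\<close> and \<open>3 + s\<close> have the hidden bit \<open>s\<close> before and after the
  flip, and \<open>5 + r\<close> reveals \<open>r\<close>.
\<close>

definition next_state :: "nat \<Rightarrow> nat \<Rightarrow> nat" where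
  "next_state p c =
     (if p = 0 then 1 + c mod 2
      else if p \<le> 2 then (if c div 2 = 0 then p + 4 else 3 + (p - 1 + c mod 2) mod 2)
      else if p \<le> 4 then 5 + (p - 3 + c div 2) mod 2
      else p)"

text \<open>Colour 2 means that no bit has been revealed yet.\<close>

definition result :: "nat \<Rightarrow> nat" where
  "result p = (if p = 5 then 0 else if p = 6 then 1 else 2)"

text \<open>One machine has two uses: it computes the colours, and it is the morphism
  \<open>h\<close> of the abstraction.\<close>

definition state :: "nat list \<Rightarrow> nat" where
  "state \<tau> = foldl next_state 0 \<tau>"

text \<open>Before the revelation, exactly the first bit is hidden from the player.\<close>

definition flip_indist :: "nat list rel" where
  "flip_indist = {(\<tau>, \<tau>'). \<tau> \<in> lists {..<4} \<and> \<tau>' \<in> lists {..<4} \<and>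
     (\<tau> = \<tau>' \<or> \<tau> \<noteq> [] \<and> \<tau>' \<noteq> [] \<and> hd \<tau> div 2 = hd \<tau>' div 2 \<and> tl \<tau> = tl \<tau>' \<and>
       state \<tau> < 5 \<and> state \<tau>' < 5)}"

definition flip_game :: "(nat, nat, nat) game" where
  "flip_game = \<lparr> moves = {..<4}, actions = {..<2}, act = (\<lambda>c. c div 2), indist = flip_indist,
     colours = {..<3}, colour = (\<lambda>\<tau>. result (state \<tau>)) \<rparr>"

section \<open>Transitions and information sets\<close>

lemma state_Nil [simp]: "state [] = 0"
  by (simp add: state_def)

lemma state_snoc [simp]: "state (\<tau> @ [c]) = next_state (state \<tau>) c"
  by (simp add: state_def)

lemma less_4_cases:
  assumes "c < (4::nat)"
  obtains "c = 0" | "c = 1" | "c = 2" | "c = 3"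
  using assms by fastforce

lemma nat_mod_2_cases:
  obtains "(n::nat) mod 2 = 0" | "n mod 2 = 1"
  by fastforce

lemma next_state_less_7: "p < 7 \<Longrightarrow> next_state p c < 7"
proof -
  have "n mod 2 < k" if "2 \<le> k" for n k :: nat
    using that by (meson mod_less_divisor order.strict_trans2 pos2)
  then show "p < 7 \<Longrightarrow> next_state p c < 7"
    by (simp add: next_state_def)
qed

lemma foldl_next_state_revealed: "5 \<le> p \<Longrightarrow> foldl next_state p \<tau> = p"
  by (induction \<tau>) (auto simp: next_state_def)

lemma state_less_7: "state \<tau> < 7"
  by (induction \<tau> rule: rev_induct) (auto simp: next_state_less_7)

text \<open>The third move at the latest leads to a revealed state, and these are absorbing.
  Nontrivial information sets therefore involve only histories of length one or two.\<close>

lemma unrevealed_cases: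
  assumes "state \<tau> < 5"
  obtains "\<tau> = []" | c where "\<tau> = [c]" | c d where "\<tau> = [c, d]" "d div 2 \<noteq> 0"
proof (cases \<tau>)
  case (Cons c \<tau>')
  show ?thesis
  proof (cases \<tau>')
    case Nil
    with Cons that show ?thesis by simp
  next
    case (Cons d \<tau>'')
    have st: "state \<tau> = foldl next_state (next_state (1 + c mod 2) d) \<tau>''"
      using \<open>\<tau> = c # \<tau>'\<close> Cons by (simp add: state_def next_state_def)
    have c: "1 + c mod 2 \<le> 2"
      by (rule nat_mod_2_cases[of c]) auto
    have d: "d div 2 \<noteq> 0"
    proof
      assume "d div 2 = 0"
      with c have "next_state (1 + c mod 2) d \<ge> 5"
        by (auto simp: next_state_def)
      with st assms show False
        by (simp add: foldl_next_state_revealed)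
    qed
    have "\<tau>'' = []"
    proof (rule ccontr)
      assume "\<tau>'' \<noteq> []"
      then obtain e \<sigma> where e: "\<tau>'' = e # \<sigma>"
        by (cases \<tau>'') auto
      have "next_state (1 + c mod 2) d \<ge> 3"
        using d c by (auto simp: next_state_def)
      then have "next_state (next_state (1 + c mod 2) d) e \<ge> 5"
        by (simp add: next_state_def[of "next_state _ _"])
      with st e assms show False
        by (simp add: foldl_next_state_revealed)
    qed
    with d Cons \<open>\<tau> = c # \<tau>'\<close> that show ?thesis by simp
  qed
qed (use that in auto)

lemma flip_indist_snocD:
  assumes "(\<tau> @ [c], \<tau>' @ [c']) \<in> flip_indist"
  shows "(\<tau>, \<tau>') \<in> flip_indist" "c div 2 = c' div 2"
proof -
  \<comment> \<open>Revealed states are absorbing, so removing the last move keeps a history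
    unrevealed.\<close>
  have "state \<tau> < 5" if "next_state (state \<tau>) c < 5" for \<tau> c
    using that by (auto simp: next_state_def split: if_splits)
  then show "(\<tau>, \<tau>') \<in> flip_indist" "c div 2 = c' div 2"
    using assms by (cases \<tau>; cases \<tau>'; auto simp: flip_indist_def simp flip: append_Cons)+
qed

lemma state_single: "state [c] = 1 + c mod 2"
  by (simp add: state_def next_state_def)

lemma state_pair:
  assumes "d div 2 \<noteq> 0"
  shows "state [c, d] = 3 + (c mod 2 + d mod 2) mod 2"
  by (rule nat_mod_2_cases[of c]) (use assms in \<open>auto simp: state_def next_state_def\<close>)

lemma same_action_moves:
  assumes "c < (4::nat)"
  shows "{c'. c' < 4 \<and> c div 2 = c' div 2} = {2 * (c div 2), 2 * (c div 2) + 1}"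
  using assms by (cases rule: less_4_cases) (auto simp: set_eq_iff elim!: less_4_cases)

text \<open>This is the image condition of rectangularity: an information set has an image that
  depends on the state alone. Letting the first bit vary produces both hidden bits, whatever the
  visible flip is.\<close>

lemma flip_indist_state:
  assumes \<tau>: "\<tau> \<in> lists {..<4}"
  shows "state ` (flip_indist `` {\<tau>}) =
    (if state \<tau> = 0 then {0} else if state \<tau> \<le> 2 then {1, 2}
     else if state \<tau> \<le> 4 then {3, 4} else {state \<tau>})"
proof (cases "state \<tau> < 5")
  case True
  then show ?thesis
  proof (cases rule: unrevealed_cases)
    case 1
    then show ?thesis
      by (auto simp: flip_indist_def image_def)
  next
    case (2 c)
    have "flip_indist `` {[c]} = (\<lambda>c'. [c']) ` {c'. c' < 4 \<and> c div 2 = c' div 2}"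
      using \<tau> 2 by (auto simp: flip_indist_def state_single image_iff length_Suc_conv neq_Nil_conv)
    moreover have "{state [2 * n], state [2 * n + 1]} = {1, 2}" for n
      by (auto simp: state_single)
    ultimately have "state ` (flip_indist `` {[c]}) = {1, 2}"
      using \<tau> 2 by (simp add: same_action_moves)
    moreover have "state \<tau> = 1 \<or> state \<tau> = 2"
      unfolding 2 state_single by (rule nat_mod_2_cases[of c]) auto
    ultimately show ?thesis
      unfolding 2 by auto
  next
    case (3 c d)
    have st: "state [c', d] = 3 + (c' mod 2 + d mod 2) mod 2" for c'
      using 3(2) by (rule state_pair)
    have bounds: "state [c', d] = 3 \<or> state [c', d] = 4" for c'
      unfolding st by (rule nat_mod_2_cases[of "c' mod 2 + d mod 2"]) auto
    have lt: "state [c', d] < 5" for c'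
      using bounds[of c'] by auto
    have "flip_indist `` {[c, d]} = (\<lambda>c'. [c', d]) ` {c'. c' < 4 \<and> c div 2 = c' div 2}"
      using \<tau> 3 by (auto simp: flip_indist_def lt image_iff neq_Nil_conv)
    \<comment> \<open>Adding a fixed flip permutes the two bits, so \<open>d\<close> disappears from
      the image.\<close>
    moreover have "{state [2 * n, d], state [2 * n + 1, d]} = {3, 4}" for n
      unfolding st by (rule nat_mod_2_cases[of d]) auto
    ultimately have "state ` (flip_indist `` {[c, d]}) = {3, 4}"
      using \<tau> 3 by (simp add: same_action_moves)
    then show ?thesis
      using bounds[of c] unfolding 3 by auto
  qed
next
  case False
  then have "flip_indist `` {\<tau>} = {\<tau>}"
    using \<tau> by (auto simp: flip_indist_def)
  with False show ?thesis
    by simp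
qed

lemma flip_indist_length: "(\<tau>, \<tau>') \<in> flip_indist \<Longrightarrow> length \<tau> = length \<tau>'"
  by (cases \<tau>; cases \<tau>') (auto simp: flip_indist_def)

section \<open>Regularity of the flip game\<close>

lemma imperfect_information_flip_game: "imperfect_information_game flip_game"
proof -
  have "equiv (lists {..<4}) flip_indist"
    by (rule equivI) (auto simp: flip_indist_def refl_on_def sym_def trans_def)
  then have "indistinguishability flip_game"
    using flip_indist_length flip_indist_snocD
    unfolding indistinguishability_def flip_game_def by auto
  moreover have "regular_colouring flip_game"
    unfolding regular_colouring_def
    by (rule exI[of _ "{..<7}"], rule exI[of _ 0], rule exI[of _ next_state], rule exI[of _ result])
      (auto simp: flip_game_def next_state_less_7 state_def result_def)
  moreover have "information_consistent flip_game"
    by (auto simp: information_consistent_def flip_game_def flip_indist_def result_def)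
  moreover have "a \<in> (\<lambda>c. c div 2) ` {..<4}" if "a < 2" for a :: nat
    using that by (intro image_eqI[of _ _ "2 * a"]) auto
  ultimately show ?thesis
    by (auto simp: imperfect_information_game_def flip_game_def lessThan_empty_iff)
qed

text \<open>A fold extends compatibly by one move and determines the colour, so the substance lies
  in \<open>flip_indist_state\<close>.\<close>

lemma rectangular_state: "rectangular_morphism flip_game (state ` lists {..<4}) state"
proof -
  have "state ` lists {..<4} \<subseteq> {..<7}"
    using state_less_7 by auto
  then have "finite (state ` lists {..<4})"
    by (rule finite_subset) simp
  then show ?thesis
    unfolding rectangular_morphism_def flip_game_def
    by (simp add: flip_indist_state result_def)
qed

lemma regular_flip_game: "regular_game flip_game"
  using imperfect_information_flip_game rectangular_state by (auto simp: regular_game_def)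

section \<open>Colours of three rounds under the copying strategy\<close>

lemma colour_pmf_3:
  "colour_pmf H \<alpha> \<beta> 3 =
     bind_pmf (step_pmf \<alpha> \<beta> []) (\<lambda>x. bind_pmf (step_pmf \<alpha> \<beta> [x]) (\<lambda>y.
       map_pmf (\<lambda>z. [col H [x], col H [x, y], col H [x, y, z]]) (step_pmf \<alpha> \<beta> [x, y])))"
  by (simp add: colour_pmf_def colours_along_def numeral_3_eq_3 map_bind_pmf bind_assoc_pmf
      bind_map_pmf bind_return_pmf map_pmf_comp)

text \<open>A fair coin decides about stopping. The guess then repeats the flip \<open>f\<close>,
  read off the second move, so that s + f + f = s is revealed modulo 2. Elsewhere action 0 is a
  default.\<close>

definition copy_strategy :: "nat list \<Rightarrow> nat pmf" where
  "copy_strategy \<tau> =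
     (if length \<tau> = 1 then pmf_of_set {..<2}
      else if length \<tau> = 2 then return_pmf (\<tau> ! 1 mod 2)
      else return_pmf 0)"

text \<open>Indistinguishable histories agree from the second move on, and the strategy reads only
  the length and that move.\<close>

lemma player_strategy_copy: "player_strategy (game_arena flip_game) copy_strategy"
proof -
  have "copy_strategy \<tau> = copy_strategy \<tau>'" if "(\<tau>, \<tau>') \<in> flip_indist" for \<tau> \<tau>'
    using that flip_indist_length[OF that]
    by (cases \<tau>; cases \<tau>') (auto simp: copy_strategy_def flip_indist_def)
  moreover have "set_pmf (copy_strategy \<tau>) \<subseteq> {..<2}" for \<tau>
    by (auto simp: copy_strategy_def lessThan_empty_iff)
  ultimately show ?thesis
    by (simp add: player_strategy_def game_arena_def flip_game_def)
qed

text \<open>\<open>C\<close> is the law of the initial bit. The coin is tossed independently of it,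
  so early and late revelation each receive half of \<open>C\<close>, whatever the environment
  does.\<close>

lemma colour_pmf_copy:
  assumes \<beta>: "environment_strategy (game_arena flip_game) \<beta>"
  obtains C where "C 0 + C 1 = (1 :: real)"
    and "\<And>r. r < 2 \<Longrightarrow> pmf (colour_pmf (game_arena flip_game) copy_strategy \<beta> 3) [2, r, r] = C r / 2"
    and "\<And>r. r < 2 \<Longrightarrow> pmf (colour_pmf (game_arena flip_game) copy_strategy \<beta> 3) [2, 2, r] = C r / 2"
proof -
  let ?G = "game_arena flip_game"
  let ?p = "map_pmf (\<lambda>x. x mod 2) (step_pmf copy_strategy \<beta> [])"
  \<comment> \<open>\<open>f b a\<close> lists the first three colours when the initial bit is
    \<open>b\<close> and the second action is \<open>a\<close>.\<close>
  define f :: "nat \<Rightarrow> nat \<Rightarrow> nat list"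
    where "f = (\<lambda>b a. if a = 0 then [2, b, b] else [2, 2, b])"
  have \<beta>D: "y < 4 \<and> y div 2 = a"
    if "y \<in> set_pmf (\<beta> \<tau> a)" "\<tau> \<in> lists {..<4}" "a < 2" for y \<tau> a
    using \<beta> that unfolding environment_strategy_def game_arena_def flip_game_def by fastforce
  have acts: "a < 2" if "a \<in> set_pmf (copy_strategy \<tau>)" for a \<tau>
    using that by (auto simp: copy_strategy_def lessThan_empty_iff split: if_splits)
  have col: "col ?G [x] = 2" "y div 2 = 0 \<Longrightarrow> col ?G [x, y] = x mod 2"
    "y div 2 = 0 \<Longrightarrow> col ?G [x, y, z] = x mod 2" "y div 2 \<noteq> 0 \<Longrightarrow> col ?G [x, y] = 2"
    "y div 2 \<noteq> 0 \<Longrightarrow> z div 2 = y mod 2 \<Longrightarrow> col ?G [x, y, z] = x mod 2" for x y z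
    by (rule nat_mod_2_cases[of x]; rule nat_mod_2_cases[of y];
        simp add: game_arena_def flip_game_def state_def next_state_def result_def)+
  have late: "map_pmf (\<lambda>z. [col ?G [x], col ?G [x, y], col ?G [x, y, z]])
      (step_pmf copy_strategy \<beta> [x, y]) = return_pmf (f (x mod 2) a)"
    if x: "x < 4" and a: "a < 2" and y: "y < 4" "y div 2 = a" for x y a
  proof -
    have "map_pmf (\<lambda>z. [col ?G [x], col ?G [x, y], col ?G [x, y, z]])
      (step_pmf copy_strategy \<beta> [x, y]) =
      map_pmf (\<lambda>z. f (x mod 2) a) (step_pmf copy_strategy \<beta> [x, y])"
    proof (rule map_pmf_cong[OF refl])
      fix z assume "z \<in> set_pmf (step_pmf copy_strategy \<beta> [x, y])"
      \<comment> \<open>The third action is the bit of \<open>y\<close> with certainty, so it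
        cancels the flip made by \<open>y\<close>.\<close>
      then have "z \<in> set_pmf (\<beta> [x, y] (y mod 2))"
        by (simp add: step_pmf_def copy_strategy_def bind_return_pmf)
      then have "z div 2 = y mod 2"
        using \<beta>D[of z "[x, y]" "y mod 2"] x y by simp
      then show "[col ?G [x], col ?G [x, y], col ?G [x, y, z]] = f (x mod 2) a"
        using y(2) col by (auto simp: f_def)
    qed
    then show ?thesis
      by simp
  qed
  have "bind_pmf (step_pmf copy_strategy \<beta> [x]) (\<lambda>y.
       map_pmf (\<lambda>z. [col ?G [x], col ?G [x, y], col ?G [x, y, z]]) (step_pmf copy_strategy \<beta> [x, y]))
     = map_pmf (f (x mod 2)) (pmf_of_set {..<2})"
    if "x \<in> set_pmf (step_pmf copy_strategy \<beta> [])" for x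
  proof -
    have x: "x < 4"
      using that \<beta>D[of x "[]"] acts by (auto simp: step_pmf_def)
    have "bind_pmf (\<beta> [x] a) (\<lambda>y. map_pmf (\<lambda>z. [col ?G [x], col ?G [x, y], col ?G [x, y, z]])
        (step_pmf copy_strategy \<beta> [x, y])) = return_pmf (f (x mod 2) a)" if "a < 2" for a
    proof -
      have "bind_pmf (\<beta> [x] a) (\<lambda>y. map_pmf (\<lambda>z. [col ?G [x], col ?G [x, y], col ?G [x, y, z]])
        (step_pmf copy_strategy \<beta> [x, y])) = bind_pmf (\<beta> [x] a) (\<lambda>y. return_pmf (f (x mod 2) a))"
        by (rule bind_pmf_cong[OF refl], rule late) (use that x \<beta>D[of _ "[x]" a] in auto)
      then show ?thesis
        by simp
    qed
    then have "bind_pmf (step_pmf copy_strategy \<beta> [x]) (\<lambda>y. map_pmf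
          (\<lambda>z. [col ?G [x], col ?G [x, y], col ?G [x, y, z]]) (step_pmf copy_strategy \<beta> [x, y]))
        = bind_pmf (copy_strategy [x]) (\<lambda>a. return_pmf (f (x mod 2) a))"
      unfolding step_pmf_def[of _ _ "[x]"] bind_assoc_pmf by (intro bind_pmf_cong refl) (use acts in blast)
    then show ?thesis
      by (simp add: copy_strategy_def map_pmf_def)
  qed
  then have T: "colour_pmf ?G copy_strategy \<beta> 3 =
      bind_pmf ?p (\<lambda>b. map_pmf (f b) (pmf_of_set {..<2}))"
    unfolding colour_pmf_3 bind_map_pmf by (intro bind_pmf_cong refl)
  have two: "{..<2} = {0, 1 :: nat}"
    by auto
  \<comment> \<open>Bits differ from colour 2, so \<open>f\<close> is injective on pairs of bits and
    exactly one outcome of the coin contributes.\<close>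
  have half: "pmf (map_pmf (f b) (pmf_of_set {..<2})) (f r a) = indicator {r} b / 2"
    if "a < 2" "b < 2" "r < 2" for a b r
  proof -
    have "{..<2} \<inter> f b -` {f r a} = (if b = r then {a} else {})"
      using that by (auto simp: f_def less_2_cases_iff)
    then show ?thesis
      by (simp add: pmf_map measure_pmf_of_set lessThan_empty_iff)
  qed
  have p2: "set_pmf ?p \<subseteq> {0, 1}"
    by auto
  have val: "pmf (colour_pmf ?G copy_strategy \<beta> 3) (f r a) = pmf ?p r / 2"
    if "a < 2" "r < 2" for a r
  proof -
    have "pmf (colour_pmf ?G copy_strategy \<beta> 3) (f r a) =
        measure_pmf.expectation ?p (\<lambda>b. indicator {r} b / 2)"
      unfolding T pmf_bind
      by (intro integral_cong_AE) (use that p2 in \<open>auto simp: AE_measure_pmf_iff half\<close>)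
    then show ?thesis
      by (simp add: measure_pmf_single)
  qed
  show thesis
  proof (rule that)
    show "pmf ?p 0 + pmf ?p 1 = 1"
      using sum_pmf_eq_1[OF _ p2] by simp
    show "pmf (colour_pmf ?G copy_strategy \<beta> 3) [2, r, r] = pmf ?p r / 2"
      "pmf (colour_pmf ?G copy_strategy \<beta> 3) [2, 2, r] = pmf ?p r / 2" if "r < 2" for r
      using val[of 0 r] val[of 1 r] that by (simp_all add: f_def)
  qed
qed

section \<open>Constant-bit environments in the abstract game\<close>

text \<open>Every move carries the bit \<open>s\<close>. If the player goes on, the flip cancels the
  initial bit and state 3 is reached for either \<open>s\<close>. The 0 before \<open>\<rho>\<close>
  supplies the initial state, which \<open>hhat\<close> does not record.\<close>

definition bit_environment :: "nat \<Rightarrow> nat list \<Rightarrow> nat \<Rightarrow> nat pmf" where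
  "bit_environment s \<rho> a = return_pmf (next_state (last (0 # \<rho>)) (2 * a + s))"

lemma last_hhat_state: "last (0 # hhat state \<tau>) = state \<tau>"
  by (cases \<tau> rule: rev_cases) auto

lemma environment_strategy_bit:
  assumes "s < 2"
  shows "environment_strategy (abstract_game flip_game state) (bit_environment s)"
proof -
  have "next_state (last (0 # hhat state \<tau>)) (2 * a + s)
      \<in> succs (abstract_game flip_game state) (hhat state \<tau>) a"
    if "\<tau> \<in> lists (moves flip_game)" "a < 2" for \<tau> a
    unfolding succs_abstract_game[OF rectangular_state that(1)] last_hhat_state
    using assms that(2) by (auto simp: flip_game_def intro!: exI[of _ "2 * a + s"])
  then show ?thesis
    unfolding environment_strategy_def bit_environment_def
    by (auto simp: abstract_game_def flip_game_def simp del: last.simps)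
qed

lemma col_abstract_flip_game:
  assumes "\<tau> \<in> lists {..<4}"
  shows "col (abstract_game flip_game state) (hhat state \<tau>) = result (state \<tau>)"
proof -
  have "moves flip_game = {..<4}" "moves flip_game \<noteq> {}"
    by (auto simp: flip_game_def lessThan_empty_iff)
  then have "col (abstract_game flip_game state) (hhat state \<tau>) = colour flip_game \<tau>"
    using assms by (intro col_abstract_game[OF rectangular_state]) simp_all
  then show ?thesis
    by (simp add: flip_game_def)
qed

text \<open>Early revelation shows \<open>s\<close>, whereas late revelation shows only the guess,
  since the hidden bit has become 0. With \<open>\<alpha>\<close> unrestricted, every nonzero second
  action goes on and guesses count modulo 2.\<close>

lemma colour_pmf_bit_environment:
  fixes \<alpha> :: "nat list \<Rightarrow> nat pmf"
  assumes s: "s < 2"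
  shows "colour_pmf (abstract_game flip_game state) \<alpha> (bit_environment s) 3 =
    bind_pmf (\<alpha> [1 + s]) (\<lambda>a. if a = 0 then return_pmf [2, s, s]
      else map_pmf (\<lambda>a'. [2, 2, a' mod 2]) (\<alpha> [1 + s, 3]))"
proof -
  let ?H = "abstract_game flip_game state"
  let ?\<beta> = "bit_environment s"
  have s01: "s = 0 \<or> s = 1"
    using s by auto
  have col: "col ?H [1 + s] = 2" "col ?H [1 + s, 5 + s] = s" "col ?H [1 + s, 5 + s, 5 + s] = s"
      "col ?H [1 + s, 3] = 2" "col ?H [1 + s, 3, 5 + a mod 2] = a mod 2" for a
  proof -
    \<comment> \<open>Abstract colours are defined through preimages, so each abstract history is
      exhibited as the image of a concrete one.\<close>
    have hh: "hhat state [s] = [1 + s]" "hhat state [s, s] = [1 + s, 5 + s]"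
      "hhat state [s, s, s] = [1 + s, 5 + s, 5 + s]" "hhat state [s, 2 + s] = [1 + s, 3]"
      "hhat state [s, 2 + s, 2 * (a mod 2)] = [1 + s, 3, 5 + a mod 2]"
      using s01 by (auto simp: hhat_def state_def next_state_def)
    have "2 * (a mod 2) < 4"
      using mod_less_divisor[of 2 a] by linarith
    then show "col ?H [1 + s] = 2" "col ?H [1 + s, 5 + s] = s" "col ?H [1 + s, 5 + s, 5 + s] = s"
      "col ?H [1 + s, 3] = 2" "col ?H [1 + s, 3, 5 + a mod 2] = a mod 2"
      using s01 unfolding hh[symmetric]
      by (subst col_abstract_flip_game; auto simp: state_def next_state_def result_def)+
  qed
  have "?\<beta> [] = (\<lambda>_. return_pmf (1 + s))"
    using s01 by (auto simp: fun_eq_iff bit_environment_def next_state_def)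
  then have step0: "step_pmf \<alpha> ?\<beta> [] = return_pmf (1 + s)"
    by (simp add: step_pmf_def)
  have step1: "step_pmf \<alpha> ?\<beta> [1 + s] = map_pmf (\<lambda>a. if a = 0 then 5 + s else 3) (\<alpha> [1 + s])"
    unfolding step_pmf_def map_pmf_def bit_environment_def
    by (rule bind_pmf_cong) (use s01 in \<open>auto simp: next_state_def\<close>)
  have step2: "step_pmf \<alpha> ?\<beta> [1 + s, 3] = map_pmf (\<lambda>a. 5 + a mod 2) (\<alpha> [1 + s, 3])"
    unfolding step_pmf_def map_pmf_def bit_environment_def
    by (rule bind_pmf_cong) (use s01 in \<open>auto simp: next_state_def\<close>)
  have "?\<beta> [1 + s, 5 + s] = (\<lambda>_. return_pmf (5 + s))"
    by (auto simp: fun_eq_iff bit_environment_def next_state_def)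
  then have step2': "step_pmf \<alpha> ?\<beta> [1 + s, 5 + s] = return_pmf (5 + s)"
    by (simp add: step_pmf_def)
  show ?thesis
    unfolding colour_pmf_3 step0 bind_return_pmf step1 bind_map_pmf
    by (rule bind_pmf_cong) (simp_all only: if_True if_False step2 step2' col map_pmf_comp
      map_return_pmf split: if_split, auto)
qed

lemma pmf_colour_bit_environment:
  fixes \<alpha> :: "nat list \<Rightarrow> nat pmf"
  assumes s: "s < 2" and r: "r < 2"
  defines "T \<equiv> colour_pmf (abstract_game flip_game state) \<alpha> (bit_environment s) 3"
  shows "pmf T [2, r, r] = (if r = s then pmf (\<alpha> [1 + s]) 0 else 0)"
    and "pmf T [2, 2, r] =
      (1 - pmf (\<alpha> [1 + s]) 0) * pmf (map_pmf (\<lambda>a. a mod 2) (\<alpha> [1 + s, 3])) r"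
proof -
  let ?v = "map_pmf (\<lambda>a. a mod 2) (\<alpha> [1 + s, 3])"
  let ?g = "\<lambda>a. if a = 0 then return_pmf [2, s, s] else map_pmf (\<lambda>a'. [2, 2, a']) ?v"
  have T: "T = bind_pmf (\<alpha> [1 + s]) ?g"
    unfolding T_def colour_pmf_bit_environment[OF s] map_pmf_comp by (rule refl)
  \<comment> \<open>As \<open>r\<close> is not 2, going on never produces
    \<open>[2, r, r]\<close>.\<close>
  have g_stop: "pmf (?g a) [2, r, r] = (if r = s then 1 else 0) * indicator {0} a" for a
    using r s by (auto simp: pmf_eq_0_set_pmf)
  show "pmf T [2, r, r] = (if r = s then pmf (\<alpha> [1 + s]) 0 else 0)"
    unfolding T pmf_bind g_stop by (simp add: measure_pmf_single)
  have "inj (\<lambda>a' :: nat. [2, 2, a'])"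
    by (simp add: inj_def)
  then have g_go: "pmf (?g a) [2, 2, r] = indicator (- {0}) a * pmf ?v r" for a
    using s pmf_map_inj'[of "\<lambda>a' :: nat. [2, 2, a']" ?v r] by auto
  show "pmf T [2, 2, r] = (1 - pmf (\<alpha> [1 + s]) 0) * pmf ?v r"
    unfolding T pmf_bind g_go
    by (simp add: measure_pmf.prob_compl[of "{0}", simplified] measure_pmf_single Compl_eq_Diff_UNIV)
qed

section \<open>Incompatible demands on the abstract player\<close>

text \<open>Before the revelation the abstract player cannot tell the two values of \<open>s\<close>
  apart, so one stopping probability and one law of guesses must serve both. Matching
  \<open>copy_strategy\<close> would require the late bit to follow \<open>s\<close>.\<close>

lemma not_reduces_flip_game:
  "\<not> reduces (game_arena flip_game) (abstract_game flip_game state)"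
proof
  let ?G = "game_arena flip_game" and ?H = "abstract_game flip_game state"
  assume "reduces ?G ?H"
  moreover have "cols ?G = cols ?H"
    by (simp add: game_arena_def abstract_game_def)
  moreover note closed_game_arena[OF imperfect_information_flip_game]
    closed_abstract_game[OF imperfect_information_flip_game rectangular_state]
    player_strategy_copy
  ultimately obtain \<alpha> where \<alpha>: "player_strategy ?H \<alpha>"
    and sim: "\<And>\<beta>'. environment_strategy ?H \<beta>' \<Longrightarrow> \<exists>\<beta>. environment_strategy ?G \<beta> \<and>
      (\<forall>n. colour_pmf ?G copy_strategy \<beta> n = colour_pmf ?H \<alpha> \<beta>' n)"
    by (elim reduces_colour_pmf[where G = ?G and H = ?H]) blast+
  \<comment> \<open>The equations compare the probabilities of \<open>[2, s, s]\<close>,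
    \<open>[2, 1 - s, 1 - s]\<close> and \<open>[2, 2, 1]\<close>; here \<open>1 - s\<close> is the
    other bit.\<close>
  have bits: "\<exists>C. C 0 + C 1 = (1 :: real) \<and> C s / 2 = pmf (\<alpha> [1 + s]) 0 \<and> C (1 - s) / 2 = 0 \<and>
      C 1 / 2 = (1 - pmf (\<alpha> [1 + s]) 0) * pmf (map_pmf (\<lambda>a. a mod 2) (\<alpha> [1 + s, 3])) 1"
    if s: "s < 2" for s
  proof -
    obtain \<beta> where \<beta>: "environment_strategy ?G \<beta>"
      and eq: "colour_pmf ?G copy_strategy \<beta> 3 = colour_pmf ?H \<alpha> (bit_environment s) 3"
      using sim[OF environment_strategy_bit[OF s]] by blast
    obtain C where "C 0 + C 1 = (1 :: real)"
      and C: "\<And>r. r < 2 \<Longrightarrow> pmf (colour_pmf ?G copy_strategy \<beta> 3) [2, r, r] = C r / 2"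
        "\<And>r. r < 2 \<Longrightarrow> pmf (colour_pmf ?G copy_strategy \<beta> 3) [2, 2, r] = C r / 2"
      using \<beta> by (rule colour_pmf_copy) blast
    moreover have "1 - s < 2" "(1::nat) < 2" "1 - s \<noteq> s"
      using s by presburger+
    then have "C s / 2 = pmf (\<alpha> [1 + s]) 0" "C (1 - s) / 2 = 0"
      "C 1 / 2 = (1 - pmf (\<alpha> [1 + s]) 0) * pmf (map_pmf (\<lambda>a. a mod 2) (\<alpha> [1 + s, 3])) 1"
      using s C(1)[of s] C(1)[of "1 - s"] C(2)[of 1] unfolding eq
      by (simp_all only: pmf_colour_bit_environment if_True if_False refl)
    ultimately show ?thesis
      by blast
  qed
  \<comment> \<open>The first pair identifies the two initial bits; the second is reflexive and
    covers the common state 3 after the flip.\<close>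
  have "([0], [1]) \<in> flip_indist" "([0, 2], [0, 2]) \<in> flip_indist"
    by (auto simp: flip_indist_def state_def next_state_def)
  then have approx: "(1, 2) \<in> approx flip_game state" "(3, 3) \<in> approx flip_game state"
    by (force simp: approx_def flip_game_def state_def next_state_def)+
  have "hhat state ` {[0], [1], [0, 2], [1, 3]} = {[1], [2], [1, 3], [2, 3]}"
    by (simp add: hhat_def state_def next_state_def, simp add: numeral_2_eq_2)
  moreover have "{[0], [1], [0, 2], [1, 3]} \<subseteq> lists (moves flip_game)"
    by (auto simp: flip_game_def)
  ultimately have "{[1], [2], [1, 3], [2, 3]} \<subseteq> hhat state ` lists (moves flip_game)"
    by (metis image_mono)
  with approx have "([1], [2]) \<in> indists ?H" "([1, 3], [2, 3]) \<in> indists ?H"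
    by (auto simp: abstract_game_def less_Suc_eq)
  then have "\<alpha> [1] = \<alpha> [2]" "\<alpha> [1, 3] = \<alpha> [2, 3]"
    using \<alpha> unfolding player_strategy_def by metis+
  \<comment> \<open>The sums stay unevaluated to match \<open>[1 + s]\<close> for \<open>s\<close>
    equal to 0 and 1.\<close>
  then have \<alpha>_eq: "\<alpha> [1 + 1] = \<alpha> [1 + 0]" "\<alpha> [1 + 1, 3] = \<alpha> [1 + 0, 3]"
    by (simp_all only: one_add_one add_0_right)
  \<comment> \<open>\<open>u\<close> is the probability of stopping and \<open>v\<close> that of an
    odd guess in state 3, both common to the two environments.\<close>
  define u v where "u = pmf (\<alpha> [1 + 0]) 0" and "v = pmf (map_pmf (\<lambda>a. a mod 2) (\<alpha> [1 + 0, 3])) 1"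
  obtain C :: "nat \<Rightarrow> real" where
    "C 0 + C 1 = 1" "C 0 / 2 = u" "C (1 - 0) / 2 = 0" "C 1 / 2 = (1 - u) * v"
    using bits[of 0] unfolding u_def v_def by auto
  \<comment> \<open>For \<open>s = 0\<close> the matching initial bit is surely 0, so a late 1 is
    impossible although going on has probability 1/2.\<close>
  then have "u = 1 / 2" "v = 0"
    by auto
  \<comment> \<open>For \<open>s = 1\<close> the early colours exclude bit 0, while
    \<open>v = 0\<close> excludes bit 1.\<close>
  moreover obtain D :: "nat \<Rightarrow> real" where
    "D 0 + D 1 = 1" "D (1 - 1) / 2 = 0" "D 1 / 2 = (1 - u) * v"
    using bits[of 1, unfolded \<alpha>_eq] unfolding u_def v_def by auto
  ultimately show False
    by simp
qed

theorem theorem8: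
  shows "\<exists>(G :: (nat, nat, nat) game) (P :: nat set) (h :: nat list \<Rightarrow> nat).
           regular_game G \<and> rectangular_morphism G P h \<and>
           \<not> alternating_probabilistic_trace_equivalent (game_arena G) (abstract_game G h)"
  using regular_flip_game rectangular_state not_reduces_flip_game
  by (auto simp: alternating_probabilistic_trace_equivalent_def)

end
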